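(* Let $G$ be a connected $(2K_2, C_3, C_4)$-free graph and let $S$ be any minimal vertex separator of $G$. Then: (i) $S$ is an independent set; (ii) if $|S|>1$, then $G - S$ has exactly one trivial component; (iii) if $G - S$ has a non-trivial component $G_1$, then for every edge $\{u,v\}\in E(G_1)$, $(N_G(u)\cap S)\cap(N_G(v)\cap S)=\emptyset$ and $(N_G(u)\cap S)\cup(N_G(v)\cap S)=S$; i.e., for every vertex $x\in S$, $N_G(x)\cap V(G_1)$ is an independent set; (iv) every vertex in a non-trivial component of $G-S$ is adjacent to exactly one vertex of $S$.
   Context: All graphs are finite, simple, undirected. For graphs $H_1,\dots,H_r$, a graph is $(H_1,\dots,H_r)$-free if it contains none of $H_1,\dots,H_r$ as an induced subgraph; $2K_2$ is the graph consisting of two disjoint edges, $C_n$ the cycle on $n$ vertices. A minimal vertex separator of a connected graph $G$ is a set $S\subseteq V(G)$ such that $G-S$ (the subgraph induced on $V(G)\setminus S$) is disconnected, and no proper subset of $S$ has this property. A component of $G-S$ is trivial if it has exactly one vertex and non-trivial otherwise. $N_G(u)$ is the neighbourhood of $u$.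
   Formalization: Item (iv) is proved only for |S|>1; for |S|=1 it is false whenever G−S has a non-trivial component (e.g. the path w–x–u–v with S={x}: v has no neighbour in S). *)

theory Defs
  imports "Graph_Theory.Graph_Theory"
begin

text \<open>
  A finite simple undirected graph is a symmetric digraph without loops and parallel arcs
  (locale \<^locale>\<open>graph\<close>): an edge {u,v} is the pair of arcs u to v and v to u.
  The connected components of such a graph are its strongly connected components.
\<close>

definition neighbourhood :: "('a, 'b) pre_digraph \<Rightarrow> 'a \<Rightarrow> 'a set" where
  "neighbourhood G u = {v. u \<rightarrow>\<^bsub>G\<^esub> v}"

definition independent_set :: "('a, 'b) pre_digraph \<Rightarrow> 'a set \<Rightarrow> bool" where
  "independent_set G X \<longleftrightarrow> X \<subseteq> verts G \<and> (\<forall>u\<in>X. \<forall>v\<in>X. \<not> u \<rightarrow>\<^bsub>G\<^esub> v)"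

definition delete_verts :: "('a, 'b) pre_digraph \<Rightarrow> 'a set \<Rightarrow> ('a, 'b) pre_digraph" where
  "delete_verts G S = G \<restriction> (verts G - S)"

text \<open>Meaningful for n at least 3.\<close>

definition cycle_graph :: "nat \<Rightarrow> nat pair_pre_digraph" where
  "cycle_graph n = \<lparr> pverts = {..<n},
     parcs = {(i, j). i < n \<and> j < n \<and> (j = (i + 1) mod n \<or> i = (j + 1) mod n)} \<rparr>"

definition two_K2 :: "nat pair_pre_digraph" where
  "two_K2 = \<lparr> pverts = {0, 1, 2, 3}, parcs = {(0, 1), (1, 0), (2, 3), (3, 2)} \<rparr>"

definition induced_free :: "nat pair_pre_digraph set \<Rightarrow> ('a, 'b) pre_digraph \<Rightarrow> bool" where
  "induced_free \<H> G \<longleftrightarrow>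
     (\<forall>H\<in>\<H>. \<not> (\<exists>H'. induced_subgraph H' G \<and> digraph_iso H' (with_proj H)))"

text \<open>
  In the library the null graph is not connected. It is not disconnected either: a disconnected
  graph has at least two components, so removing all vertices does not disconnect a graph.
\<close>

definition disconnected :: "('a, 'b) pre_digraph \<Rightarrow> bool" where
  "disconnected G \<longleftrightarrow> verts G \<noteq> {} \<and> \<not> connected G"

definition separator :: "('a, 'b) pre_digraph \<Rightarrow> 'a set \<Rightarrow> bool" where
  "separator G S \<longleftrightarrow> S \<subseteq> verts G \<and> disconnected (delete_verts G S)"

definition minimal_separator :: "('a, 'b) pre_digraph \<Rightarrow> 'a set \<Rightarrow> bool" where
  "minimal_separator G S \<longleftrightarrow> separator G S \<and> (\<forall>T. T \<subset> S \<longrightarrow> \<not> separator G T)"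

definition trivial_components :: "('a, 'b) pre_digraph \<Rightarrow> ('a, 'b) pre_digraph set" where
  "trivial_components G = {C \<in> pre_digraph.sccs G. card (verts C) = 1}"

definition nontrivial_components :: "('a, 'b) pre_digraph \<Rightarrow> ('a, 'b) pre_digraph set" where
  "nontrivial_components G = {C \<in> pre_digraph.sccs G. card (verts C) \<noteq> 1}"

end

theory Submission
  imports Defs
begin

text \<open>
  By minimality every vertex of S has a neighbour in every component of G - S. Since G has no
  induced 2K2, at most one component is non-trivial, so some component is a single vertex w, and
  the neighbourhood of w is exactly S. Everything follows by looking at w together with few other
  vertices: an edge inside S makes a triangle with w; a second trivial component, or a vertex of a
  non-trivial component with two neighbours in S, makes an induced C4 with w; an edge of a
  non-trivial component that misses x in S makes an induced 2K2 with the edge from w to x.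
\<close>

lemma (in nomulti_digraph) induced_copyI:
  assumes inj: "inj_on f (pverts H)"
    and verts: "f ` pverts H \<subseteq> verts G"
    and wf: "parcs H \<subseteq> pverts H \<times> pverts H"
    and arcs: "\<And>i j. i \<in> pverts H \<Longrightarrow> j \<in> pverts H \<Longrightarrow> (i, j) \<in> parcs H \<longleftrightarrow> f i \<rightarrow>\<^bsub>G\<^esub> f j"
  shows "\<exists>H'. induced_subgraph H' G \<and> digraph_iso H' (with_proj H)"
proof -
  let ?V = "f ` pverts H"
  let ?H' = "G \<restriction> ?V"
  define g where "g = the_inv_into (pverts H) f"
  define hom where "hom = \<lparr> iso_verts = g, iso_arcs = (\<lambda>e. (g (tail G e), g (head G e))),
    iso_head = snd, iso_tail = fst \<rparr>"
  have g_f [simp]: "g (f i) = i" if "i \<in> pverts H" for i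
    using the_inv_into_f_f[OF inj that] by (simp add: g_def)
  have g_inj: "inj_on g ?V"
    by (auto intro!: inj_onI)
  have "inj_on (iso_arcs hom) (arcs ?H')"
  proof (rule inj_onI)
    fix e1 e2
    assume e: "e1 \<in> arcs ?H'" "e2 \<in> arcs ?H'" "iso_arcs hom e1 = iso_arcs hom e2"
    then have "tail G e1 = tail G e2" "head G e1 = head G e2"
      using g_inj by (auto simp: hom_def)
    with e show "e1 = e2"
      by (auto intro: no_multi_arcs simp: arc_to_ends_def)
  qed
  then have hom: "pre_digraph.digraph_isomorphism ?H' hom"
    using g_inj wellformed_induce_subgraph
    by (auto simp: pre_digraph.digraph_isomorphism_def hom_def)
  have "iso_arcs hom ` arcs ?H' = parcs H"
  proof (intro set_eqI iffI)
    fix p assume "p \<in> iso_arcs hom ` arcs ?H'"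
    then obtain e i j where e: "e \<in> arcs G" "tail G e = f i" "head G e = f j"
        "i \<in> pverts H" "j \<in> pverts H" "p = (i, j)"
      by (auto simp: hom_def)
    then have "f i \<rightarrow>\<^bsub>G\<^esub> f j"
      by (auto intro: dominatesI simp: arc_to_ends_def)
    with e arcs show "p \<in> parcs H" by simp
  next
    fix p assume p: "p \<in> parcs H"
    obtain i j where ij: "p = (i, j)" by (cases p)
    with p wf have V: "i \<in> pverts H" "j \<in> pverts H" by auto
    with p ij arcs have "f i \<rightarrow>\<^bsub>G\<^esub> f j" by simp
    then obtain e where "e \<in> arcs G" "tail G e = f i" "head G e = f j"
      by (rule reachableE)
    with V ij show "p \<in> iso_arcs hom ` arcs ?H'"
      by (auto simp: hom_def intro!: rev_image_eqI[of e])
  qed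
  moreover have "iso_verts hom ` ?V = pverts H"
    by (auto simp: hom_def image_image)
  ultimately have "with_proj H = app_iso hom ?H'"
    by (auto simp: app_iso_def with_proj_def) (simp_all add: hom_def)
  with hom verts show ?thesis
    unfolding digraph_iso_def by blast
qed

lemma pverts_two_K2: "pverts two_K2 = {0, 1, 2, 3}"
  and parcs_two_K2: "parcs two_K2 = {(0, 1), (1, 0), (2, 3), (3, 2)}"
  by (simp_all add: two_K2_def)

lemma pverts_cycle_3: "pverts (cycle_graph 3) = {0, 1, 2}"
  and pverts_cycle_4: "pverts (cycle_graph 4) = {0, 1, 2, 3}"
  by (auto simp: cycle_graph_def)

lemma parcs_cycle_subset: "parcs (cycle_graph n) \<subseteq> pverts (cycle_graph n) \<times> pverts (cycle_graph n)"
  by (auto simp: cycle_graph_def)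

lemma in_parcs_cycle_iff:
  "(i, j) \<in> parcs (cycle_graph n) \<longleftrightarrow> i \<in> pverts (cycle_graph n) \<and> j \<in> pverts (cycle_graph n) \<and>
    (j = (i + 1) mod n \<or> i = (j + 1) mod n)"
  by (simp add: cycle_graph_def)

context graph
begin

lemma dominates_commute: "u \<rightarrow>\<^bsub>G\<^esub> v \<longleftrightarrow> v \<rightarrow>\<^bsub>G\<^esub> u"
  using graph_symmetric by blast

lemma dominates_irrefl: "\<not> u \<rightarrow>\<^bsub>G\<^esub> u"
  using adj_not_same by blast

lemma two_K2_free:
  assumes free: "induced_free \<H> G" "two_K2 \<in> \<H>"
    and edges: "a \<rightarrow>\<^bsub>G\<^esub> b" "c \<rightarrow>\<^bsub>G\<^esub> d"
  shows "a \<rightarrow>\<^bsub>G\<^esub> c \<or> a \<rightarrow>\<^bsub>G\<^esub> d \<or> b \<rightarrow>\<^bsub>G\<^esub> c \<or> b \<rightarrow>\<^bsub>G\<^esub> d"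
proof (rule ccontr)
  assume no: "\<not> ?thesis"
  define f where "f = (\<lambda>n. [a, b, c, d] ! n)"
  have f [simp]: "f 0 = a" "f (Suc 0) = b" "f 2 = c" "f 3 = d"
    by (simp_all add: f_def)
  have "a \<noteq> b" "c \<noteq> d"
    using edges dominates_irrefl by metis+
  moreover have "a \<noteq> c" "a \<noteq> d" "b \<noteq> c" "b \<noteq> d"
    using no edges graph_symmetric by metis+
  ultimately have "distinct [a, b, c, d]"
    by simp
  then have "inj_on f (pverts two_K2)"
    by (auto simp: inj_on_def pverts_two_K2)
  moreover have "f ` pverts two_K2 \<subseteq> verts G"
    using edges[THEN adj_in_verts(1)] edges[THEN adj_in_verts(2)] by (simp add: pverts_two_K2)
  moreover have "(i, j) \<in> parcs two_K2 \<longleftrightarrow> f i \<rightarrow>\<^bsub>G\<^esub> f j"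
    if "i \<in> pverts two_K2" "j \<in> pverts two_K2" for i j
    using that no edges unfolding pverts_two_K2 parcs_two_K2
    by (elim insertE emptyE; simp add: dominates_commute dominates_irrefl)
  moreover have "parcs two_K2 \<subseteq> pverts two_K2 \<times> pverts two_K2"
    by (auto simp: pverts_two_K2 parcs_two_K2)
  ultimately have "\<exists>H'. induced_subgraph H' G \<and> digraph_iso H' (with_proj two_K2)"
    by (intro induced_copyI)
  with free show False by (auto simp: induced_free_def)
qed

lemma triangle_free:
  assumes free: "induced_free \<H> G" "cycle_graph 3 \<in> \<H>"
    and edges: "a \<rightarrow>\<^bsub>G\<^esub> b" "b \<rightarrow>\<^bsub>G\<^esub> c"
  shows "\<not> a \<rightarrow>\<^bsub>G\<^esub> c"
proof
  assume "a \<rightarrow>\<^bsub>G\<^esub> c"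
  note edges = edges this
  define f where "f = (\<lambda>n. [a, b, c] ! n)"
  have f [simp]: "f 0 = a" "f (Suc 0) = b" "f 2 = c"
    by (simp_all add: f_def)
  have "distinct [a, b, c]"
    using edges dominates_irrefl by (simp, metis)
  then have "inj_on f (pverts (cycle_graph 3))"
    by (auto simp: inj_on_def pverts_cycle_3)
  moreover have "f ` pverts (cycle_graph 3) \<subseteq> verts G"
    using edges[THEN adj_in_verts(1)] edges[THEN adj_in_verts(2)] by (simp add: pverts_cycle_3)
  moreover have "(i, j) \<in> parcs (cycle_graph 3) \<longleftrightarrow> f i \<rightarrow>\<^bsub>G\<^esub> f j"
    if "i \<in> pverts (cycle_graph 3)" "j \<in> pverts (cycle_graph 3)" for i j
    using that edges graph_symmetric[OF edges(1)] graph_symmetric[OF edges(2)] graph_symmetric[OF edges(3)]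
    unfolding in_parcs_cycle_iff pverts_cycle_3
    by (elim insertE emptyE; simp add: dominates_irrefl)
  ultimately have "\<exists>H'. induced_subgraph H' G \<and> digraph_iso H' (with_proj (cycle_graph 3))"
    by (intro induced_copyI parcs_cycle_subset)
  with free show False by (auto simp: induced_free_def)
qed

lemma four_cycle_chord:
  assumes free: "induced_free \<H> G" "cycle_graph 4 \<in> \<H>"
    and edges: "a \<rightarrow>\<^bsub>G\<^esub> b" "b \<rightarrow>\<^bsub>G\<^esub> c" "c \<rightarrow>\<^bsub>G\<^esub> d" "d \<rightarrow>\<^bsub>G\<^esub> a" and ne: "a \<noteq> c" "b \<noteq> d"
  shows "a \<rightarrow>\<^bsub>G\<^esub> c \<or> b \<rightarrow>\<^bsub>G\<^esub> d"
proof (rule ccontr)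
  assume no: "\<not> ?thesis"
  define f where "f = (\<lambda>n. [a, b, c, d] ! n)"
  have f [simp]: "f 0 = a" "f (Suc 0) = b" "f 2 = c" "f 3 = d"
    by (simp_all add: f_def)
  have "distinct [a, b, c, d]"
    using ne edges dominates_irrefl by (simp, metis)
  then have "inj_on f (pverts (cycle_graph 4))"
    by (auto simp: inj_on_def pverts_cycle_4)
  moreover have "f ` pverts (cycle_graph 4) \<subseteq> verts G"
    using edges[THEN adj_in_verts(1)] by (simp add: pverts_cycle_4)
  moreover have "(i, j) \<in> parcs (cycle_graph 4) \<longleftrightarrow> f i \<rightarrow>\<^bsub>G\<^esub> f j"
    if "i \<in> pverts (cycle_graph 4)" "j \<in> pverts (cycle_graph 4)" for i j
    using that no edges unfolding in_parcs_cycle_iff pverts_cycle_4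
    by (elim insertE emptyE; simp add: dominates_commute dominates_irrefl)
  ultimately have "\<exists>H'. induced_subgraph H' G \<and> digraph_iso H' (with_proj (cycle_graph 4))"
    by (intro induced_copyI parcs_cycle_subset)
  with free show False by (auto simp: induced_free_def)
qed

end

lemma verts_delete_verts [simp]: "verts (delete_verts G S) = verts G - S"
  by (simp add: delete_verts_def)

lemma dominates_induce_subgraph_iff:
  "u \<rightarrow>\<^bsub>G \<restriction> W\<^esub> v \<longleftrightarrow> u \<in> W \<and> v \<in> W \<and> u \<rightarrow>\<^bsub>G\<^esub> v"
  by (auto simp: arcs_ends_conv)

lemma (in graph) sym_digraph_delete_verts: "sym_digraph (delete_verts G S)"
  unfolding delete_verts_def by (rule induced_graph_imp_graph) auto

context sym_digraph
begin

lemma scc_closed: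
  assumes "C \<in> sccs" "u \<in> verts C" "u \<rightarrow>\<^bsub>G\<^esub> v"
  shows "v \<in> verts C"
proof -
  have "verts C \<in> sccs_verts"
    using assms by (intro in_sccs_vertsI_sccs) auto
  moreover have "u \<rightarrow>\<^sup>* v" "v \<rightarrow>\<^sup>* u"
    using assms(3) graph_symmetric[OF assms(3)] by auto
  ultimately show ?thesis
    using assms by (auto simp: in_sccs_verts_conv_reachable)
qed

lemma dominates_scc_iff:
  assumes "C \<in> sccs"
  shows "u \<rightarrow>\<^bsub>C\<^esub> v \<longleftrightarrow> u \<in> verts C \<and> v \<in> verts C \<and> u \<rightarrow>\<^bsub>G\<^esub> v"
  using dominates_induce_subgraph_iff[where G = G and W = "verts C"]
    induce_eq_iff_induced[OF in_sccs_imp_induced[OF assms]] by simp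

lemma scc_subset:
  assumes "C \<in> sccs"
  shows "verts C \<subseteq> verts G"
  using assms by auto

lemma scc_nonempty:
  assumes "C \<in> sccs"
  shows "verts C \<noteq> {}"
  using assms by (auto simp: sccs_def strongly_connected_def)

lemma nontrivial_scc_neighbour:
  assumes C: "C \<in> sccs" "card (verts C) \<noteq> 1" and u: "u \<in> verts C"
  obtains v where "v \<in> verts C" "u \<rightarrow>\<^bsub>G\<^esub> v"
proof -
  from C(2) u obtain w where w: "w \<in> verts C" "w \<noteq> u"
    by (metis is_singletonI' is_singleton_altdef empty_iff)
  from C(1) u w have "u \<rightarrow>\<^sup>*\<^bsub>C\<^esub> w"
    by (auto simp: sccs_def strongly_connected_def)
  with w(2) obtain v where "u \<rightarrow>\<^bsub>C\<^esub> v"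
    by (cases rule: pre_digraph.converse_reachable_cases) auto
  with C(1) that show thesis by (auto simp: dominates_scc_iff)
qed

lemma disconnected_other_scc:
  assumes disc: "disconnected G" and C: "C \<in> sccs"
  obtains D where "D \<in> sccs" "D \<noteq> C"
proof -
  obtain u v where uv: "u \<in> verts G" "v \<in> verts G" "\<not> u \<rightarrow>\<^sup>* v"
    using disc reachable_mk_symmetricI unfolding disconnected_def by (blast intro: connectedI)
  have "\<exists>w \<in> verts G. w \<notin> verts C"
  proof (rule ccontr)
    assume "\<not> ?thesis"
    with uv have "u \<rightarrow>\<^sup>*\<^bsub>C\<^esub> v"
      using C by (auto simp: sccs_def strongly_connected_def)
    then have "u \<rightarrow>\<^sup>* v"
      using C in_sccs_imp_induced induced_imp_subgraph reachable_mono by blast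
    with uv show False by simp
  qed
  then obtain w where w: "w \<in> verts G" "w \<notin> verts C" by blast
  then have "G \<restriction> {v. w \<rightarrow>\<^sup>* v} \<in> sccs" "G \<restriction> {v. w \<rightarrow>\<^sup>* v} \<noteq> C"
    using induce_reachable_is_in_sccs by auto
  then show thesis by (rule that)
qed

end

locale separated_graph = graph G for G :: "('a, 'b) pre_digraph" (structure) +
  fixes S :: "'a set"
  assumes free: "induced_free {two_K2, cycle_graph 3, cycle_graph 4} G"
    and min_sep: "minimal_separator G S"
begin

abbreviation "K \<equiv> delete_verts G S"

sublocale K: sym_digraph K
  by (rule sym_digraph_delete_verts)

lemma sep_subset: "S \<subseteq> verts G"
  and disconnected_K: "disconnected K"
  using min_sep by (auto simp: minimal_separator_def separator_def)

lemma dominates_K_iff: "u \<rightarrow>\<^bsub>K\<^esub> v \<longleftrightarrow> u \<notin> S \<and> v \<notin> S \<and> u \<rightarrow>\<^bsub>G\<^esub> v"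
  using adj_in_verts by (auto simp: delete_verts_def dominates_induce_subgraph_iff)

lemma component_subset:
  assumes "C \<in> K.sccs" "u \<in> verts C"
  shows "u \<in> verts G" "u \<notin> S"
  using K.scc_subset[OF assms(1)] assms(2) by auto

lemma component_closed:
  assumes "C \<in> K.sccs" "u \<in> verts C" "u \<rightarrow>\<^bsub>G\<^esub> v" "v \<notin> S"
  shows "v \<in> verts C"
  using assms component_subset by (auto intro: K.scc_closed simp: dominates_K_iff)

lemma separator_neighbour_in_component:
  assumes x: "x \<in> S" and C: "C \<in> K.sccs"
  obtains u where "u \<in> verts C" "x \<rightarrow>\<^bsub>G\<^esub> u"
proof (rule ccontr)
  assume "\<not> thesis"
  with that have no: "\<not> u \<rightarrow>\<^bsub>G\<^esub> x" if "u \<in> verts C" for u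
    using that dominates_commute by blast
  let ?L = "delete_verts G (S - {x})"
  interpret L: sym_digraph ?L
    by (rule sym_digraph_delete_verts)
  have "\<not> separator G (S - {x})"
    using min_sep x by (auto simp: minimal_separator_def)
  then have "connected ?L"
    using x sep_subset by (auto simp: separator_def disconnected_def)
  then have "strongly_connected ?L"
    by (intro L.symmetric_connected_imp_strongly_connected L.sym_arcs)
  moreover obtain u where u: "u \<in> verts C"
    using K.scc_nonempty[OF C] by blast
  ultimately have "u \<rightarrow>\<^sup>*\<^bsub>?L\<^esub> x"
    using x sep_subset component_subset[OF C u] by (auto simp: strongly_connected_def)
  then have "x \<in> verts C"
  proof (induct rule: L.reachable_induct)
    case base show ?case by (fact u)
  next
    case (step y z)
    then have "y \<rightarrow>\<^bsub>G\<^esub> z" "z \<notin> S - {x}"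
      by (simp_all add: delete_verts_def dominates_induce_subgraph_iff)
    moreover from this step(3) no have "z \<notin> S" by blast
    ultimately show ?case
      using component_closed[OF C step(3)] by blast
  qed
  with x C show False using component_subset by blast
qed

lemma nontrivial_component_unique:
  assumes C: "C \<in> K.sccs" "card (verts C) \<noteq> 1" and D: "D \<in> K.sccs" "card (verts D) \<noteq> 1"
  shows "C = D"
proof (rule ccontr)
  assume "C \<noteq> D"
  then have disj: "verts C \<inter> verts D = {}"
    using C D by (intro K.scc_disj)
  obtain a where a: "a \<in> verts C" using K.scc_nonempty C by blast
  obtain b where b: "b \<in> verts C" "a \<rightarrow>\<^bsub>K\<^esub> b"
    using K.nontrivial_scc_neighbour[OF C a] by blast
  obtain c where c: "c \<in> verts D" using K.scc_nonempty D by blast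
  obtain d where d: "d \<in> verts D" "c \<rightarrow>\<^bsub>K\<^esub> d"
    using K.nontrivial_scc_neighbour[OF D c] by blast
  have "\<not> s \<rightarrow>\<^bsub>G\<^esub> t" if "s \<in> verts C" "t \<in> verts D" for s t
    using that component_closed[OF C(1)] component_subset D(1) disj by blast
  moreover have "a \<rightarrow>\<^bsub>G\<^esub> b" "c \<rightarrow>\<^bsub>G\<^esub> d"
    using b d by (auto simp: dominates_K_iff)
  ultimately show False
    using two_K2_free[OF free] a b(1) c d(1) by blast
qed

lemma trivial_component_exists:
  obtains w where "K \<restriction> {w} \<in> K.sccs"
proof -
  obtain u where "u \<in> verts K"
    using disconnected_K by (auto simp: disconnected_def)
  then obtain C where C: "C \<in> K.sccs"
    using K.induce_reachable_is_in_sccs by blast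
  then obtain D where D: "D \<in> K.sccs" "D \<noteq> C"
    using K.disconnected_other_scc[OF disconnected_K] by blast
  from C D nontrivial_component_unique obtain E where E: "E \<in> K.sccs" "card (verts E) = 1"
    by blast
  then obtain w where "verts E = {w}"
    by (auto simp: card_1_singleton_iff)
  with E K.in_sccs_imp_induced K.induce_eq_iff_induced have "K \<restriction> {w} \<in> K.sccs" by metis
  then show thesis by (rule that)
qed

lemma trivial_component_neighbours:
  assumes w: "K \<restriction> {w} \<in> K.sccs"
  shows "w \<rightarrow>\<^bsub>G\<^esub> v \<longleftrightarrow> v \<in> S"
proof
  assume "v \<in> S"
  then show "w \<rightarrow>\<^bsub>G\<^esub> v"
    using separator_neighbour_in_component[OF _ w, of v] dominates_commute[of w v] by auto
next
  assume "w \<rightarrow>\<^bsub>G\<^esub> v"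
  then show "v \<in> S"
    using component_closed[OF w, of w v] dominates_irrefl by auto
qed

lemma separator_independent:
  assumes "x \<in> S" "y \<in> S"
  shows "\<not> x \<rightarrow>\<^bsub>G\<^esub> y"
proof -
  obtain w where w: "K \<restriction> {w} \<in> K.sccs" by (rule trivial_component_exists)
  with assms have "w \<rightarrow>\<^bsub>G\<^esub> x" "w \<rightarrow>\<^bsub>G\<^esub> y"
    by (auto simp: trivial_component_neighbours)
  with triangle_free[OF free] show ?thesis by blast
qed

lemma no_second_common_neighbour:
  assumes w: "K \<restriction> {w} \<in> K.sccs" and u: "u \<notin> S" "u \<noteq> w"
    and xy: "x \<in> S" "y \<in> S" "u \<rightarrow>\<^bsub>G\<^esub> x" "u \<rightarrow>\<^bsub>G\<^esub> y"
  shows "x = y"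
proof (rule ccontr)
  assume "x \<noteq> y"
  moreover have "w \<rightarrow>\<^bsub>G\<^esub> x" "y \<rightarrow>\<^bsub>G\<^esub> w"
    using w xy trivial_component_neighbours dominates_commute[of y w] by auto
  ultimately have "w \<rightarrow>\<^bsub>G\<^esub> u \<or> x \<rightarrow>\<^bsub>G\<^esub> y"
    using four_cycle_chord[OF free] xy u(2) dominates_commute by blast
  with w u xy separator_independent show False
    by (auto simp: trivial_component_neighbours)
qed

lemma trivial_component_unique:
  assumes "x \<in> S" "y \<in> S" "x \<noteq> y" and w: "K \<restriction> {w} \<in> K.sccs" and w': "K \<restriction> {w'} \<in> K.sccs"
  shows "w = w'"
  using assms no_second_common_neighbour[OF w, of w' x y] component_subset[OF w', of w']
  by (auto simp: trivial_component_neighbours)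

lemma nontrivial_component_edge:
  assumes C: "C \<in> K.sccs" "card (verts C) \<noteq> 1" and uv: "u \<in> verts C" "v \<in> verts C" "u \<rightarrow>\<^bsub>G\<^esub> v"
    and x: "x \<in> S"
  shows "u \<rightarrow>\<^bsub>G\<^esub> x \<longleftrightarrow> \<not> v \<rightarrow>\<^bsub>G\<^esub> x"
proof -
  obtain w where w: "K \<restriction> {w} \<in> K.sccs" by (rule trivial_component_exists)
  have "u \<notin> S" "v \<notin> S" using C uv component_subset by auto
  then have "\<not> w \<rightarrow>\<^bsub>G\<^esub> u" "\<not> w \<rightarrow>\<^bsub>G\<^esub> v" using w by (auto simp: trivial_component_neighbours)
  moreover have "w \<rightarrow>\<^bsub>G\<^esub> x" using w x by (simp add: trivial_component_neighbours)
  ultimately have "x \<rightarrow>\<^bsub>G\<^esub> u \<or> x \<rightarrow>\<^bsub>G\<^esub> v"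
    using two_K2_free[OF free _ \<open>w \<rightarrow>\<^bsub>G\<^esub> x\<close> uv(3)] by auto
  moreover have "\<not> (u \<rightarrow>\<^bsub>G\<^esub> x \<and> v \<rightarrow>\<^bsub>G\<^esub> x)"
    using triangle_free[OF free] uv by blast
  ultimately show ?thesis using dominates_commute by blast
qed

lemma nontrivial_component_ex1_neighbour:
  assumes C: "C \<in> K.sccs" "card (verts C) \<noteq> 1" and u: "u \<in> verts C"
    and S: "p \<in> S" "q \<in> S" "p \<noteq> q"
  shows "\<exists>!x. x \<in> S \<and> u \<rightarrow>\<^bsub>G\<^esub> x"
proof -
  obtain w where w: "K \<restriction> {w} \<in> K.sccs" by (rule trivial_component_exists)
  have "verts C \<inter> {w} = {}"
    using K.scc_disj[OF C(1) w] C(2) by fastforce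
  then have unique: "x = y"
    if "t \<in> verts C" "x \<in> S" "y \<in> S" "t \<rightarrow>\<^bsub>G\<^esub> x" "t \<rightarrow>\<^bsub>G\<^esub> y" for t x y
    using that no_second_common_neighbour[OF w, of t x y] component_subset[OF C(1)] by blast
  obtain v where v: "v \<in> verts C" "u \<rightarrow>\<^bsub>K\<^esub> v"
    using K.nontrivial_scc_neighbour[OF C u] by blast
  then have "u \<rightarrow>\<^bsub>G\<^esub> v" by (simp add: dominates_K_iff)
  then have "u \<rightarrow>\<^bsub>G\<^esub> p \<or> u \<rightarrow>\<^bsub>G\<^esub> q"
    using nontrivial_component_edge[OF C u v(1)] unique[OF v(1)] S by blast
  with unique[OF u] S show ?thesis by blast
qed

end

theorem theorem5:
  fixes G :: "('a, 'b) pre_digraph" and S :: "'a set"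
  assumes "graph G"
    and "connected G"
    and "induced_free {two_K2, cycle_graph 3, cycle_graph 4} G"
    and "minimal_separator G S"
  shows "independent_set G S \<and>
    (card S > 1 \<longrightarrow> (\<exists>!C. C \<in> trivial_components (delete_verts G S))) \<and>
    (\<forall>C \<in> nontrivial_components (delete_verts G S).
       (\<forall>u v. u \<rightarrow>\<^bsub>C\<^esub> v \<longrightarrow>
          (neighbourhood G u \<inter> S) \<inter> (neighbourhood G v \<inter> S) = {} \<and>
          (neighbourhood G u \<inter> S) \<union> (neighbourhood G v \<inter> S) = S) \<and>
       (\<forall>x \<in> S. independent_set G (neighbourhood G x \<inter> verts C))) \<and>
    (card S > 1 \<longrightarrow> (\<forall>C \<in> nontrivial_components (delete_verts G S).
       \<forall>u \<in> verts C. \<exists>!x. x \<in> S \<and> u \<rightarrow>\<^bsub>G\<^esub> x))"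
proof -
  interpret separated_graph G S
    using assms by (simp add: separated_graph_def separated_graph_axioms_def)
  have "independent_set G S"
    using sep_subset separator_independent by (auto simp: independent_set_def)
  moreover have "\<exists>!C. C \<in> trivial_components K" if card: "card S > 1"
  proof -
    obtain x y where xy: "x \<in> S" "y \<in> S" "x \<noteq> y"
      using card card_le_Suc0_iff_eq[of S] card_ge_0_finite[of S] by fastforce
    obtain w where w: "K \<restriction> {w} \<in> K.sccs" by (rule trivial_component_exists)
    show ?thesis
    proof (rule ex1I)
      show "K \<restriction> {w} \<in> trivial_components K"
        using w by (simp add: trivial_components_def)
    next
      fix C assume "C \<in> trivial_components K"
      then obtain w' where w': "C \<in> K.sccs" "verts C = {w'}"
        by (auto simp: trivial_components_def card_1_singleton_iff)
      then have C: "C = K \<restriction> {w'}"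
        using K.in_sccs_imp_induced K.induce_eq_iff_induced by metis
      with w' trivial_component_unique[OF xy w] show "C = K \<restriction> {w}" by simp
    qed
  qed
  moreover have "(neighbourhood G u \<inter> S) \<inter> (neighbourhood G v \<inter> S) = {} \<and>
      (neighbourhood G u \<inter> S) \<union> (neighbourhood G v \<inter> S) = S"
    if "C \<in> nontrivial_components K" "u \<rightarrow>\<^bsub>C\<^esub> v" for C u v
  proof -
    from that have C: "C \<in> K.sccs" "card (verts C) \<noteq> 1"
      by (simp_all add: nontrivial_components_def)
    with that(2) have "u \<in> verts C" "v \<in> verts C" "u \<rightarrow>\<^bsub>G\<^esub> v"
      by (auto simp: K.dominates_scc_iff dominates_K_iff)
    from nontrivial_component_edge[OF C this] show ?thesis
      by (auto simp: neighbourhood_def)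
  qed
  moreover have "independent_set G (neighbourhood G x \<inter> verts C)" for x C
    using adj_in_verts triangle_free[OF free, of x] unfolding independent_set_def neighbourhood_def
    by blast
  moreover have "\<exists>!x. x \<in> S \<and> u \<rightarrow>\<^bsub>G\<^esub> x"
    if card: "card S > 1" and C: "C \<in> nontrivial_components K" and u: "u \<in> verts C" for C u
  proof -
    obtain p q where "p \<in> S" "q \<in> S" "p \<noteq> q"
      using card card_le_Suc0_iff_eq[of S] card_ge_0_finite[of S] by fastforce
    with C u show ?thesis
      by (intro nontrivial_component_ex1_neighbour) (auto simp: nontrivial_components_def)
  qed
  ultimately show ?thesis by blast
qed

end
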